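(* Let $\ell\ge3$. A partition $\lambda$ is a node of the crystal $B(\Lambda_0)^L$ if and only if there is no box $(i,j)\in\lambda$ with $h^\lambda_{(i,j)}=\ell\cdot\mathrm{arm}(i,j)$.
   Context: Young diagrams in English notation; $(a,b)$ is the box in row $a$, column $b$, residue $b-a\bmod\ell$. For a box $(i,j)$: $\mathrm{arm}(i,j)=\lambda_i-j$, $\mathrm{leg}(i,j)=\lambda'_j-i$, hook length $h^\lambda_{(i,j)}=\mathrm{arm}(i,j)+\mathrm{leg}(i,j)+1$. Removable (resp. addable) $i$-box: a box in $\lambda$ (resp. position not in $\lambda$) of residue $i$ whose removal (resp. addition) yields a partition. The ladder of $(a,b)$ is the set of positions $(c,d)$, $c,d\ge1$, with $c+(\ell-1)d=a+(\ell-1)b$; ladders are ordered left to right by increasing $c+(\ell-1)d$, within a ladder top to bottom by increasing row index. The ladder $i$-signature writes $+$ for each addable $i$-box and $-$ for each removable $i$-box, reading ladders left to right and each ladder top to bottom; repeatedly deleting adjacent "$-+$" gives $+\cdots+-\cdots-$; the box of the rightmost remaining $+$ is the ladder cogood $i$-box and $\widehat f_i\lambda$ is $\lambda$ with it added ($0$ if none). The nodes of $B(\Lambda_0)^L$ are the partitions obtainable from the empty partition by finite sequences of the $\widehat f_i$, $0\le i<\ell$. *)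

theory Defs
  imports Main "HOL-Library.Product_Lexorder"
begin

text \<open>
  A partition is identified with its Young diagram in English notation: a finite set of boxes
  \<open>(row, column)\<close>, numbered from 1, that is closed under moving up and to the left.
\<close>

type_synonym box = "nat \<times> nat"

definition young_diagram :: "box set \<Rightarrow> bool" where
  "young_diagram D \<longleftrightarrow>
     finite D \<and>
     (\<forall>(a, b)\<in>D. 1 \<le> a \<and> 1 \<le> b) \<and>
     (\<forall>(a, b)\<in>D. \<forall>c d. 1 \<le> c \<and> c \<le> a \<and> 1 \<le> d \<and> d \<le> b \<longrightarrow> (c, d) \<in> D)"

definition row_length :: "box set \<Rightarrow> nat \<Rightarrow> nat" where
  "row_length D i = card {j. (i, j) \<in> D}"

definition col_length :: "box set \<Rightarrow> nat \<Rightarrow> nat" where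
  "col_length D j = card {i. (i, j) \<in> D}"

text \<open>Arm and leg use truncated subtraction; they are only meant for boxes of the diagram,
  where no truncation occurs.\<close>

definition arm :: "box set \<Rightarrow> box \<Rightarrow> nat" where
  "arm D = (\<lambda>(i, j). row_length D i - j)"

definition leg :: "box set \<Rightarrow> box \<Rightarrow> nat" where
  "leg D = (\<lambda>(i, j). col_length D j - i)"

definition hook_length :: "box set \<Rightarrow> box \<Rightarrow> nat" where
  "hook_length D x = arm D x + leg D x + 1"

definition residue :: "nat \<Rightarrow> box \<Rightarrow> int" where
  "residue l = (\<lambda>(a, b). (int b - int a) mod int l)"

definition addable :: "nat \<Rightarrow> int \<Rightarrow> box set \<Rightarrow> box \<Rightarrow> bool" where
  "addable l i D x \<longleftrightarrow> x \<notin> D \<and> residue l x = i \<and> young_diagram (insert x D)"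

definition removable :: "nat \<Rightarrow> int \<Rightarrow> box set \<Rightarrow> box \<Rightarrow> bool" where
  "removable l i D x \<longleftrightarrow> x \<in> D \<and> residue l x = i \<and> young_diagram (D - {x})"

text \<open>
  The ladder of \<open>(a, b)\<close> is determined by \<open>a + (l - 1) b\<close>.  Sorting lexicographically by this
  number and then by the row index reads the ladders from left to right and each ladder from
  top to bottom.
\<close>

definition ladder_key :: "nat \<Rightarrow> box \<Rightarrow> nat \<times> nat" where
  "ladder_key l = (\<lambda>(a, b). (a + (l - 1) * b, a))"

datatype sign = Plus | Minus

text \<open>Each sign of the signature is stored together with the box it comes from.\<close>

definition ladder_signature :: "nat \<Rightarrow> int \<Rightarrow> box set \<Rightarrow> (sign \<times> box) list" where
  "ladder_signature l i D =
     map (\<lambda>x. (if addable l i D x then Plus else Minus, x))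
       (sorted_key_list_of_set (ladder_key l) {x. addable l i D x \<or> removable l i D x})"

inductive cancel :: "(sign \<times> 'a) list \<Rightarrow> (sign \<times> 'a) list \<Rightarrow> bool" where
  "cancel (us @ (Minus, x) # (Plus, y) # vs) (us @ vs)"

definition reduced_signature :: "(sign \<times> 'a) list \<Rightarrow> (sign \<times> 'a) list" where
  "reduced_signature s = (THE t. cancel\<^sup>*\<^sup>* s t \<and> (\<nexists>u. cancel t u))"

definition ladder_cogood :: "nat \<Rightarrow> int \<Rightarrow> box set \<Rightarrow> box option" where
  "ladder_cogood l i D =
     (let ps = filter (\<lambda>(s, x). s = Plus) (reduced_signature (ladder_signature l i D))
      in if ps = [] then None else Some (snd (last ps)))"

text \<open>\<open>None\<close> plays the role of the value \<open>0\<close>.\<close>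

definition f_hat :: "nat \<Rightarrow> int \<Rightarrow> box set \<Rightarrow> box set option" where
  "f_hat l i D = map_option (\<lambda>x. insert x D) (ladder_cogood l i D)"

inductive_set ladder_crystal_nodes :: "nat \<Rightarrow> box set set" for l :: nat where
  empty: "{} \<in> ladder_crystal_nodes l"
| step: "\<lbrakk>D \<in> ladder_crystal_nodes l; 0 \<le> i; i < int l; f_hat l i D = Some E\<rbrakk>
           \<Longrightarrow> E \<in> ladder_crystal_nodes l"


text \<open>
  The definite description and the sorted list above are well defined: the reduction ends in a
  unique word, which is computed by the function \<open>reduce\<close>, the boxes in the signature form a
  finite set, and \<open>ladder_key\<close> is injective on boxes.
\<close>

fun push :: "sign \<times> 'a \<Rightarrow> (sign \<times> 'a) list \<Rightarrow> (sign \<times> 'a) list" where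
  "push x [] = [x]"
| "push x (y # ys) = (if fst x = Minus \<and> fst y = Plus then ys else x # y # ys)"

definition reduce :: "(sign \<times> 'a) list \<Rightarrow> (sign \<times> 'a) list" where
  "reduce s = foldr push s []"

lemma push_Minus_Plus: "push (Minus, x) (push (Plus, y) r) = r"
  by (cases r) auto

lemma cancel_reduce_eq: "cancel s t \<Longrightarrow> reduce s = reduce t"
  by (induction rule: cancel.induct) (simp add: reduce_def push_Minus_Plus)

lemma cancels_reduce_eq: "cancel\<^sup>*\<^sup>* s t \<Longrightarrow> reduce s = reduce t"
  by (induction rule: rtranclp_induct) (auto dest: cancel_reduce_eq)

lemma cancel_Cons: "cancel s t \<Longrightarrow> cancel (x # s) (x # t)"
  by (erule cancel.cases) (use cancel.intros[of "x # _"] in auto)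

lemma cancels_Cons: "cancel\<^sup>*\<^sup>* s t \<Longrightarrow> cancel\<^sup>*\<^sup>* (x # s) (x # t)"
  by (induction rule: rtranclp_induct) (auto intro: cancel_Cons rtranclp.rtrancl_into_rtrancl)

lemma cancels_push: "cancel\<^sup>*\<^sup>* (x # s) (push x s)"
proof (cases s)
  case (Cons y ys)
  then show ?thesis
    using cancel.intros[of "[]" "snd x" "snd y" ys]
    by (cases x; cases y) auto
qed auto

lemma cancels_reduce: "cancel\<^sup>*\<^sup>* s (reduce s)"
proof (induction s)
  case (Cons x s)
  then show ?case
    using cancels_Cons[OF Cons, of x] cancels_push[of x "reduce s"]
    by (simp add: reduce_def)
qed (simp add: reduce_def)

lemma reduce_shape:
  "\<exists>ps ms. reduce s = ps @ ms \<and> (\<forall>p\<in>set ps. fst p = Plus) \<and> (\<forall>m\<in>set ms. fst m = Minus)"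
proof (induction s)
  case Nil
  then show ?case by (simp add: reduce_def)
next
  case (Cons x s)
  then obtain ps ms where *: "reduce s = ps @ ms"
    "\<forall>p\<in>set ps. fst p = Plus" "\<forall>m\<in>set ms. fst m = Minus" by blast
  have r: "reduce (x # s) = push x (reduce s)" by (simp add: reduce_def)
  show ?case
  proof (cases "fst x")
    case Plus
    then have "reduce (x # s) = (x # ps) @ ms"
      using r * by (cases "ps @ ms") auto
    then show ?thesis using * Plus by (metis set_ConsD)
  next
    case Minus
    show ?thesis
    proof (cases ps)
      case Nil
      then have "reduce (x # s) = [] @ (x # ms)"
        using r * Minus by (cases ms) auto
      then show ?thesis using * Minus by (metis empty_iff empty_set set_ConsD)
    next
      case (Cons p ps')
      then have "reduce (x # s) = ps' @ ms" using r * Minus by auto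
      then show ?thesis using * Cons by (metis list.set_intros(2))
    qed
  qed
qed

lemma reduce_irreducible: "\<not> cancel (reduce s) u"
proof
  assume "cancel (reduce s) u"
  then obtain us x y vs where eq: "reduce s = us @ (Minus, x) # (Plus, y) # vs"
    by (auto elim: cancel.cases)
  obtain ps ms where *: "reduce s = ps @ ms"
    "\<forall>p\<in>set ps. fst p = Plus" "\<forall>m\<in>set ms. fst m = Minus"
    using reduce_shape by blast
  have e: "ps @ ms = us @ (Minus, x) # (Plus, y) # vs" using eq * by simp
  show False
  proof (cases "length ps \<le> length us")
    case True
    then have "(Plus, y) \<in> set ms"
      using e by (auto simp: append_eq_append_conv2 append_eq_append_conv_if)
    then show False using * by fastforce
  next
    case False
    have "(ps @ ms) ! length us = (Minus, x)" using e by simp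
    then have "(Minus, x) \<in> set ps" using False by (metis linorder_not_le nth_append nth_mem)
    then show False using * by fastforce
  qed
qed

lemma irreducible_reduce_eq: "\<nexists>u. cancel t u \<Longrightarrow> reduce t = t"
  by (metis cancels_reduce converse_rtranclpE)

lemma reduced_signature_unique:
  "cancel\<^sup>*\<^sup>* s t \<and> (\<nexists>u. cancel t u) \<longleftrightarrow> t = reduce s"
  by (metis cancels_reduce cancels_reduce_eq irreducible_reduce_eq reduce_irreducible)

lemma reduced_signature_eq_reduce: "reduced_signature s = reduce s"
  unfolding reduced_signature_def reduced_signature_unique by simp

lemma inj_ladder_key: "l \<ge> 2 \<Longrightarrow> inj (ladder_key l)"
  by (auto simp: inj_def ladder_key_def)

lemma finite_signature_boxes:
  "finite {x. addable l i D x \<or> removable l i D x}"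
proof (cases "finite D")
  case False
  then show ?thesis by (simp add: addable_def removable_def young_diagram_def)
next
  case True
  let ?B = "{..Suc (Max (insert 0 (fst ` D)))} \<times> {..Suc (Max (insert 0 (snd ` D)))}"
  have "(a, b) \<in> ?B" if "addable l i D (a, b)" for a b
  proof -
    have cl: "(c, d) \<in> insert (a, b) D" if "1 \<le> c" "c \<le> a" "1 \<le> d" "d \<le> b" for c d
    proof -
      have "\<forall>(a', b')\<in>insert (a, b) D. \<forall>c d. 1 \<le> c \<and> c \<le> a' \<and> 1 \<le> d \<and> d \<le> b'
              \<longrightarrow> (c, d) \<in> insert (a, b) D"
        using \<open>addable l i D (a, b)\<close> unfolding addable_def young_diagram_def by blast
      from this[THEN bspec, of "(a, b)"] show ?thesis using that by simp
    qed
    have pos: "1 \<le> a" "1 \<le> b"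
      using \<open>addable l i D (a, b)\<close> by (auto simp: addable_def young_diagram_def)
    have "a \<le> Suc (Max (insert 0 (fst ` D)))"
    proof (cases "a = 1")
      case False
      then have "(a - 1, b) \<in> D" using cl[of "a - 1" b] pos by (cases a) auto
      then have "a - 1 \<in> fst ` D" by force
      then have "a - 1 \<le> Max (insert 0 (fst ` D))"
        using \<open>finite D\<close> by (intro Max_ge) auto
      then show ?thesis by simp
    qed simp
    moreover have "b \<le> Suc (Max (insert 0 (snd ` D)))"
    proof (cases "b = 1")
      case False
      then have "(a, b - 1) \<in> D" using cl[of a "b - 1"] pos by (cases b) auto
      then have "b - 1 \<in> snd ` D" by force
      then have "b - 1 \<le> Max (insert 0 (snd ` D))"
        using \<open>finite D\<close> by (intro Max_ge) auto
      then show ?thesis by simp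
    qed simp
    ultimately show ?thesis by simp
  qed
  then have "{x. addable l i D x \<or> removable l i D x} \<subseteq> ?B \<union> D"
    by (auto simp: removable_def)
  then show ?thesis using True by (meson finite_SigmaI finite_Un finite_atMost finite_subset)
qed

end

theory Submission
  imports Defs
begin

text \<open>
  Call a hook illegal if its length is \<open>l\<close> times its arm.  The key observation is that a
  removable box followed by an addable box of the same residue, either lower in the same ladder or
  in the next ladder of that residue and not in a lower row, always spans an illegal hook.
  If adding the cogood box \<open>y\<close> to a diagram without illegal hooks created one, then the end of
  that hook other than \<open>y\<close> would give a further addable box \<open>z\<close> just after \<open>y\<close>; by the
  observation no removable box lies between \<open>y\<close> and \<open>z\<close>, so \<open>y\<close> could not be the rightmost
  surviving \<open>Plus\<close>.  Dually, removing the leftmost surviving \<open>Minus\<close> creates no illegal hook and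
  is undone by \<open>f_hat\<close>.  In a nonempty diagram without illegal hooks the last box in
  reading order is a \<open>Minus\<close> with no later \<open>Plus\<close> of its residue, so some \<open>Minus\<close> survives and
  one can descend to the empty diagram.
\<close>

section \<open>Words of signs\<close>

lemma cancels_append: "cancel\<^sup>*\<^sup>* s t \<Longrightarrow> cancel\<^sup>*\<^sup>* (s @ r) (t @ r)"
proof (induction rule: rtranclp_induct)
  case (step t u)
  have "cancel (t @ r) (u @ r)"
    using step(2) by (cases rule: cancel.cases) (use cancel.intros in fastforce)
  with step.IH show ?case by (rule rtranclp.rtrancl_into_rtrancl)
qed simp

text \<open>Cancellations inside a prefix are cancellations of the whole word, and these do not
  change the value of \<open>reduce\<close>.\<close>

lemma reduce_append: "reduce (s @ t) = reduce (reduce s @ t)"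
  using cancels_reduce_eq[OF cancels_append[OF cancels_reduce]] .

lemma reduce_Cons: "reduce (x # s) = push x (reduce s)"
  by (simp add: reduce_def)

lemma reduce_Nil: "reduce [] = []"
  by (simp add: reduce_def)

lemma push_Plus: "fst x = Plus \<Longrightarrow> push x s = x # s"
  by (cases s) auto

lemma push_onto_Minus: "\<forall>p\<in>set s. fst p = Minus \<Longrightarrow> push x s = x # s"
  by (cases s) auto

lemma reduce_Plus_append: "\<forall>p\<in>set us. fst p = Plus \<Longrightarrow> reduce (us @ s) = us @ reduce s"
  by (induction us) (simp_all add: reduce_Cons push_Plus)

lemma reduce_Minus: "\<forall>p\<in>set s. fst p = Minus \<Longrightarrow> reduce s = s"
  by (induction s) (simp_all add: reduce_Cons push_onto_Minus, simp add: reduce_def)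

lemma last_push_Minus:
  "s \<noteq> [] \<Longrightarrow> fst (last s) = Minus \<Longrightarrow> push x s \<noteq> [] \<and> last (push x s) = last s"
  by (cases s) auto

text \<open>A \<open>Minus\<close> can only be deleted by a \<open>Plus\<close> to its right, so a
  trailing block of \<open>Minus\<close> survives.\<close>

lemma last_reduce_append_Minus:
  assumes "t \<noteq> []" "\<forall>p\<in>set t. fst p = Minus"
  shows "reduce (us @ t) \<noteq> [] \<and> last (reduce (us @ t)) = last t"
proof (induction us)
  case Nil
  show ?case using assms by (simp add: reduce_Minus)
next
  case (Cons x us)
  moreover have "fst (last t) = Minus" using assms by simp
  ultimately show ?case
    using last_push_Minus[of "reduce (us @ t)" x] by (simp add: reduce_Cons)
qed

text \<open>The sign between \<open>us\<close> and \<open>vs\<close> survives the reduction, as the last \<open>Plus\<close> or the first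
  \<open>Minus\<close> to do so.  The condition does not refer to the sign itself, which is why \<open>f_hat\<close>
  undoes the removal of the first surviving removable box.\<close>

definition pivot :: "(sign \<times> 'a) list \<Rightarrow> (sign \<times> 'a) list \<Rightarrow> bool" where
  "pivot us vs \<longleftrightarrow> (\<forall>p\<in>set (reduce us). fst p = Plus) \<and> (\<forall>p\<in>set (reduce vs). fst p = Minus)"

text \<open>Only \<open>Plus\<close> is left over before \<open>x\<close> and only
  \<open>Minus\<close> after it, so \<open>x\<close> finds no partner, whichever sign it
  has.\<close>

lemma reduce_pivot:
  assumes "pivot us vs"
  shows "reduce (us @ x # vs) = reduce us @ x # reduce vs"
  using assms
  by (subst reduce_append) (simp add: pivot_def reduce_Plus_append reduce_Cons push_onto_Minus)

text \<open>The split is at the last surviving \<open>Plus\<close>. The induction puts letters in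
  front: once found, \<open>vs\<close> stays fixed and only the left part has to be checked
  again.\<close>

lemma ex_Plus_pivot:
  assumes "p \<in> set (reduce s)" "fst p = Plus"
  shows "\<exists>us y vs. s = us @ (Plus, y) # vs \<and> pivot us vs"
  using assms
proof (induction s arbitrary: p)
  case Nil
  then show ?case by (simp add: reduce_def)
next
  case (Cons a s)
  show ?case
  proof (cases "\<exists>p\<in>set (reduce s). fst p = Plus")
    case True
    then obtain us y vs where s: "s = us @ (Plus, y) # vs" and piv: "pivot us vs"
      using Cons.IH by blast
    have "\<forall>p\<in>set (reduce (a # us)). fst p = Plus"
    proof (cases "fst a")
      case Plus
      then show ?thesis using piv by (simp add: pivot_def reduce_Cons push_Plus)
    next
      case Minus
      show ?thesis
      proof (cases "reduce us")
        case Nil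
        \<comment> \<open>The new \<open>Minus\<close> cancels \<open>y\<close>, the only surviving
          \<open>Plus\<close>, contrary to the assumption that a \<open>Plus\<close> survives in
          \<open>a # s\<close>.\<close>
        then have "reduce (a # s) = reduce vs"
          using piv Minus by (simp add: s reduce_Cons reduce_pivot)
        then show ?thesis using Cons.prems piv by (auto simp: pivot_def)
      next
        case (Cons b bs)
        then show ?thesis using piv Minus by (auto simp: pivot_def reduce_Cons)
      qed
    qed
    then have "a # s = (a # us) @ (Plus, y) # vs \<and> pivot (a # us) vs"
      using s piv by (simp add: pivot_def)
    then show ?thesis by blast
  next
    case False
    then have *: "\<forall>p\<in>set (reduce s). fst p = Minus"
      using sign.exhaust by blast
    then have "reduce (a # s) = a # reduce s"
      by (simp add: reduce_Cons push_onto_Minus)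
    then have "p = a" using Cons.prems * by auto
    then have "a # s = [] @ (Plus, snd a) # s \<and> pivot [] s"
      using Cons.prems * by (cases a) (simp add: pivot_def reduce_def)
    then show ?thesis by blast
  qed
qed

text \<open>The split is at the first surviving \<open>Minus\<close>. Unlike the last surviving
  \<open>Plus\<close>, it can change when a letter is put in front: a \<open>Minus\<close> that
  finds no \<open>Plus\<close> to cancel takes over.\<close>

lemma ex_Minus_pivot:
  assumes "p \<in> set (reduce s)" "fst p = Minus"
  shows "\<exists>us y vs. s = us @ (Minus, y) # vs \<and> pivot us vs"
  using assms
proof (induction s arbitrary: p)
  case Nil
  then show ?case by (simp add: reduce_def)
next
  case (Cons a s)
  show ?case
  proof (cases "\<exists>p\<in>set (reduce s). fst p = Minus")
    case True
    then obtain us y vs where s: "s = us @ (Minus, y) # vs" and piv: "pivot us vs"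
      using Cons.IH by blast
    show ?thesis
    proof (cases "fst a = Minus \<and> reduce us = []")
      case True
      then have "a # s = [] @ (Minus, snd a) # s \<and> pivot [] s"
        using piv by (cases a) (auto simp: s pivot_def reduce_pivot[OF piv] reduce_Nil)
      then show ?thesis by blast
    next
      case False
      then have "\<forall>p\<in>set (reduce (a # us)). fst p = Plus"
        using piv sign.exhaust[of "fst a"]
        by (cases "reduce us") (auto simp: pivot_def reduce_Cons reduce_Nil)
      then have "a # s = (a # us) @ (Minus, y) # vs \<and> pivot (a # us) vs"
        using s piv by (simp add: pivot_def)
      then show ?thesis by blast
    qed
  next
    case False
    then have *: "\<forall>p\<in>set (reduce s). fst p = Plus"
      using sign.exhaust by blast
    have a: "fst a = Minus"
    proof (rule ccontr)
      assume "fst a \<noteq> Minus"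
      then have "fst a = Plus" using sign.exhaust by blast
      then show False using Cons.prems * by (auto simp: reduce_Cons push_Plus)
    qed
    \<comment> \<open>Otherwise \<open>a\<close> would cancel the leading \<open>Plus\<close> and no
      \<open>Minus\<close> would survive.\<close>
    have "reduce s = []"
      using Cons.prems * a by (cases "reduce s") (auto simp: reduce_Cons)
    then have "a # s = [] @ (Minus, snd a) # s \<and> pivot [] s"
      using a by (cases a) (simp add: pivot_def reduce_def)
    then show ?thesis by blast
  qed
qed

text \<open>No \<open>Plus\<close> of \<open>vs\<close> survives, so \<open>p\<close> must be
  cancelled by a \<open>Minus\<close> standing between the pivot and \<open>p\<close>.\<close>

lemma pivot_Plus_right:
  assumes "pivot us vs" "vs = ms @ p # vs'" "fst p = Plus"
  shows "\<exists>m\<in>set ms. fst m = Minus"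
proof (rule ccontr)
  assume "\<not> ?thesis"
  then have "\<forall>m\<in>set ms. fst m = Plus" using sign.exhaust by blast
  then have "reduce vs = ms @ p # reduce vs'"
    using assms by (simp add: reduce_Plus_append reduce_Cons push_Plus)
  then show False using assms by (simp add: pivot_def)
qed

text \<open>No \<open>Minus\<close> of \<open>us\<close> survives, so \<open>p\<close> must be
  cancelled by a \<open>Plus\<close> standing between \<open>p\<close> and the pivot.\<close>

lemma pivot_Minus_left:
  assumes "pivot us vs" "us = us' @ p # ms" "fst p = Minus"
  shows "\<exists>m\<in>set ms. fst m = Plus"
proof (rule ccontr)
  assume "\<not> ?thesis"
  then have *: "\<forall>m\<in>set (p # ms). fst m = Minus"
    using assms(3) sign.exhaust by (metis set_ConsD)
  then have "reduce us \<noteq> []" "last (reduce us) = last (p # ms)"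
    using last_reduce_append_Minus[of "p # ms" us'] assms by auto
  then have "last (p # ms) \<in> set (reduce us)" by (metis last_in_set)
  moreover have "fst (last (p # ms)) = Minus"
    using bspec[OF *, of "last (p # ms)"] last_in_set[of "p # ms"] by blast
  ultimately show False using assms by (auto simp: pivot_def)
qed

section \<open>Diagrams and illegal hooks\<close>

lemma young_diagram_pos: "young_diagram D \<Longrightarrow> (a, b) \<in> D \<Longrightarrow> 1 \<le> a \<and> 1 \<le> b"
  unfolding young_diagram_def by blast

lemma young_diagram_closed:
  assumes "young_diagram D" "(a, b) \<in> D" "1 \<le> c" "c \<le> a" "1 \<le> d" "d \<le> b"
  shows "(c, d) \<in> D"
proof -
  have "\<forall>(a, b)\<in>D. \<forall>c d. 1 \<le> c \<and> c \<le> a \<and> 1 \<le> d \<and> d \<le> b \<longrightarrow> (c, d) \<in> D"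
    using assms(1) unfolding young_diagram_def by blast
  from bspec[OF this assms(2)] show ?thesis using assms by simp
qed

lemma young_diagramI:
  assumes "finite D" "\<And>a b. (a, b) \<in> D \<Longrightarrow> 1 \<le> a \<and> 1 \<le> b"
    "\<And>a b c d. (a, b) \<in> D \<Longrightarrow> 1 \<le> c \<Longrightarrow> c \<le> a \<Longrightarrow> 1 \<le> d \<Longrightarrow> d \<le> b \<Longrightarrow> (c, d) \<in> D"
  shows "young_diagram D"
  unfolding young_diagram_def using assms by blast

lemma addable_iff:
  assumes "young_diagram D"
  shows "addable l i D (a, b) \<longleftrightarrow> residue l (a, b) = i \<and> (a, b) \<notin> D \<and> 1 \<le> a \<and> 1 \<le> b \<and>
    (a = 1 \<or> (a - 1, b) \<in> D) \<and> (b = 1 \<or> (a, b - 1) \<in> D)" (is "?L \<longleftrightarrow> ?R")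
proof
  assume L: ?L
  then have y: "young_diagram (insert (a, b) D)" by (simp add: addable_def)
  have pos: "1 \<le> a" "1 \<le> b" using young_diagram_pos[OF y, of a b] by simp_all
  have "a = 1 \<or> 1 \<le> a - 1" "b = 1 \<or> 1 \<le> b - 1" using pos by linarith+
  then have "a = 1 \<or> (a - 1, b) \<in> D" "b = 1 \<or> (a, b - 1) \<in> D"
    using young_diagram_closed[OF y, of a b "a - 1" b] young_diagram_closed[OF y, of a b a "b - 1"] pos
    by auto
  then show ?R using L pos by (simp add: addable_def)
next
  assume R: ?R
  have "young_diagram (insert (a, b) D)"
  proof (rule young_diagramI)
    show "finite (insert (a, b) D)" using assms by (simp add: young_diagram_def)
  next
    fix c d assume "(c, d) \<in> insert (a, b) D"
    then show "1 \<le> c \<and> 1 \<le> d" using R young_diagram_pos[OF assms] by auto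
  next
    fix p q c d
    assume pq: "(p, q) \<in> insert (a, b) D" and cd: "1 \<le> c" "c \<le> p" "1 \<le> d" "d \<le> q"
    show "(c, d) \<in> insert (a, b) D"
    proof (cases "(c, d) \<in> D")
      case no: False
      have eq: "p = a \<and> q = b"
        using pq cd no young_diagram_closed[OF assms, of p q c d] by auto
      have "c = a"
      proof (rule ccontr)
        assume "c \<noteq> a"
        then have "c \<le> a - 1" "a \<noteq> 1" using cd eq by auto
        then show False using R young_diagram_closed[OF assms, of "a - 1" b c d] cd eq no by auto
      qed
      moreover have "d = b"
      proof (rule ccontr)
        assume "d \<noteq> b"
        then have "d \<le> b - 1" "b \<noteq> 1" using cd eq by auto
        then show False using R young_diagram_closed[OF assms, of a "b - 1" c d] cd eq no by auto
      qed
      ultimately show ?thesis by blast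
    qed simp
  qed
  then show ?L using R by (simp add: addable_def)
qed

lemma removable_iff:
  assumes "young_diagram D"
  shows "removable l i D (a, b) \<longleftrightarrow> residue l (a, b) = i \<and> (a, b) \<in> D \<and>
    (Suc a, b) \<notin> D \<and> (a, Suc b) \<notin> D" (is "?L \<longleftrightarrow> ?R")
proof
  assume L: ?L
  then have y: "young_diagram (D - {(a, b)})" and "(a, b) \<in> D" by (simp_all add: removable_def)
  then have "1 \<le> a \<and> 1 \<le> b" using young_diagram_pos[OF assms] by simp
  then show ?R
    using L young_diagram_closed[OF y, of "Suc a" b a b] young_diagram_closed[OF y, of a "Suc b" a b]
    by (auto simp: removable_def)
next
  assume R: ?R
  have "young_diagram (D - {(a, b)})"
  proof (rule young_diagramI)
    show "finite (D - {(a, b)})" using assms by (simp add: young_diagram_def)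
  next
    fix c d assume "(c, d) \<in> D - {(a, b)}"
    then show "1 \<le> c \<and> 1 \<le> d" using young_diagram_pos[OF assms] by auto
  next
    fix p q c d
    assume "(p, q) \<in> D - {(a, b)}" and cd: "1 \<le> c" "c \<le> p" "1 \<le> d" "d \<le> q"
    then have pq: "(p, q) \<in> D" "\<not> (p = a \<and> q = b)" by auto
    \<comment> \<open>Another box weakly below and to the right of \<open>(a, b)\<close> would force
      \<open>(Suc a, b)\<close> or \<open>(a, Suc b)\<close> into \<open>D\<close>.\<close>
    have "(c, d) \<noteq> (a, b)"
      using R pq cd young_diagram_closed[OF assms, of p q "Suc a" b]
        young_diagram_closed[OF assms, of p q a "Suc b"]
      by (cases "p = a") auto
    then show "(c, d) \<in> D - {(a, b)}"
      using young_diagram_closed[OF assms pq(1) cd] by simp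
  qed
  then show ?L using R by (simp add: removable_def)
qed

section \<open>Row and column lengths, and hooks described by their two ends\<close>

lemma initial_segment_eq:
  fixes S :: "nat set"
  assumes "finite S" "\<And>x. x \<in> S \<Longrightarrow> 1 \<le> x \<and> {1..x} \<subseteq> S"
  shows "S = {1..card S}"
proof (cases "S = {}")
  case False
  then have "S = {1..Max S}"
    using assms Max_in[OF assms(1)] by (fastforce intro: Max_ge)
  then show ?thesis by (metis card_atLeastAtMost diff_Suc_1)
qed simp

lemma row_eq:
  assumes "young_diagram D"
  shows "{j. (i, j) \<in> D} = {1..row_length D i}"
  unfolding row_length_def
proof (rule initial_segment_eq)
  have "{j. (i, j) \<in> D} \<subseteq> snd ` D" by force
  then show "finite {j. (i, j) \<in> D}"
    using assms by (meson finite_imageI finite_subset young_diagram_def)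
next
  fix x assume "x \<in> {j. (i, j) \<in> D}"
  then have x: "(i, x) \<in> D" by simp
  show "1 \<le> x \<and> {1..x} \<subseteq> {j. (i, j) \<in> D}"
    using young_diagram_pos[OF assms x] young_diagram_closed[OF assms x] by auto
qed

lemma col_eq:
  assumes "young_diagram D"
  shows "{i. (i, j) \<in> D} = {1..col_length D j}"
  unfolding col_length_def
proof (rule initial_segment_eq)
  have "{i. (i, j) \<in> D} \<subseteq> fst ` D" by force
  then show "finite {i. (i, j) \<in> D}"
    using assms by (meson finite_imageI finite_subset young_diagram_def)
next
  fix x assume "x \<in> {i. (i, j) \<in> D}"
  then have x: "(x, j) \<in> D" by simp
  show "1 \<le> x \<and> {1..x} \<subseteq> {i. (i, j) \<in> D}"
    using young_diagram_pos[OF assms x] young_diagram_closed[OF assms x] by auto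
qed

text \<open>A hook of arm \<open>m\<close> and length \<open>(k + 1) m\<close>, given by its hand \<open>(i, j + m)\<close>
  and its foot \<open>(i + k m - 1, j)\<close>.\<close>

definition illegal :: "nat \<Rightarrow> box set \<Rightarrow> bool" where
  "illegal k D \<longleftrightarrow> (\<exists>i j m. 1 \<le> m \<and> (i, j + m) \<in> D \<and> (i, Suc (j + m)) \<notin> D \<and>
     (i + k * m - 1, j) \<in> D \<and> (i + k * m, j) \<notin> D)"

lemma illegalI:
  assumes "1 \<le> m" "(i, j + m) \<in> D" "(i, Suc (j + m)) \<notin> D"
    "(i + k * m - 1, j) \<in> D" "(i + k * m, j) \<notin> D"
  shows "illegal k D"
  using assms unfolding illegal_def by blast

lemma illegalE:
  assumes "illegal k D"
  obtains i j m where "1 \<le> m" "(i, j + m) \<in> D" "(i, Suc (j + m)) \<notin> D"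
    "(i + k * m - 1, j) \<in> D" "(i + k * m, j) \<notin> D"
  using assms unfolding illegal_def by blast

text \<open>With arm \<open>m\<close>, the equation says that the leg is \<open>k * m - 1\<close>,
  so the column of the corner \<open>(i, j)\<close> ends in row \<open>i + k * m - 1\<close>. Arm
  zero is excluded because hook lengths are positive.\<close>

lemma ex_hook_iff_illegal:
  assumes "young_diagram D" "1 \<le> k"
  shows "(\<exists>x\<in>D. hook_length D x = Suc k * arm D x) \<longleftrightarrow> illegal k D"
proof
  have row: "(a, b) \<in> D \<longleftrightarrow> 1 \<le> b \<and> b \<le> row_length D a" for a b
    using eqset_imp_iff[OF row_eq[OF assms(1), of a], of b] by simp
  have col: "(a, b) \<in> D \<longleftrightarrow> 1 \<le> a \<and> a \<le> col_length D b" for a b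
    using eqset_imp_iff[OF col_eq[OF assms(1), of b], of a] by simp
  {
    assume "\<exists>x\<in>D. hook_length D x = Suc k * arm D x"
    then obtain i j where ij: "(i, j) \<in> D" and h: "hook_length D (i, j) = Suc k * arm D (i, j)"
      by auto
    define m where "m = row_length D i - j"
    have pos: "1 \<le> i" "1 \<le> j" using ij young_diagram_pos[OF assms(1)] by auto
    have r: "row_length D i = j + m" using ij row m_def by auto
    have c: "i \<le> col_length D j" using ij col by auto
    have "m + (col_length D j - i) + 1 = m + k * m"
      using h by (simp add: hook_length_def arm_def leg_def m_def)
    then have *: "Suc (col_length D j) = i + k * m" using c by linarith
    show "illegal k D"
    proof (rule illegalI)
      show "1 \<le> m" using * c by (cases m) auto
      show "(i, j + m) \<in> D" "(i, Suc (j + m)) \<notin> D" using row r pos by auto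
      show "(i + k * m - 1, j) \<in> D" "(i + k * m, j) \<notin> D" using col * c pos by auto
    qed
  next
    assume "illegal k D"
    then obtain i j m where m: "1 \<le> m" and D: "(i, j + m) \<in> D" "(i, Suc (j + m)) \<notin> D"
      "(i + k * m - 1, j) \<in> D" "(i + k * m, j) \<notin> D" by (rule illegalE)
    have km: "1 \<le> k * m" using m assms by simp
    have pos: "1 \<le> i" "1 \<le> j" using D young_diagram_pos[OF assms(1)] by auto
    have ij: "(i, j) \<in> D" using young_diagram_closed[OF assms(1) D(1), of i j] pos by simp
    have r: "row_length D i = j + m" using D row[of i "j + m"] row[of i "Suc (j + m)"] by auto
    have c: "col_length D j = i + k * m - 1"
      using D col[of "i + k * m - 1" j] col[of "i + k * m" j] by auto
    have "hook_length D (i, j) = Suc k * arm D (i, j)"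
      using r c km by (simp add: hook_length_def arm_def leg_def)
    then show "\<exists>x\<in>D. hook_length D x = Suc k * arm D x" using ij by blast
  }
qed

section \<open>Ladders and illegal hooks\<close>

text \<open>Modulo \<open>Suc k\<close> the factor \<open>k\<close> is -1, so the ladder number
  \<open>a + k * b\<close> is congruent to minus the content \<open>b - a\<close>.\<close>

lemma residue_eq_iff:
  "residue (Suc k) (a, b) = residue (Suc k) (c, d) \<longleftrightarrow>
   int (Suc k) dvd int (a + k * b) - int (c + k * d)"
proof -
  have "residue (Suc k) (a, b) = residue (Suc k) (c, d) \<longleftrightarrow>
        int (Suc k) dvd (int b - int a) - (int d - int c)"
    unfolding residue_def by (simp add: mod_eq_dvd_iff)
  moreover have "int (a + k * b) - int (c + k * d) =
      int (Suc k) * (int b - int d) - ((int b - int a) - (int d - int c))"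
    by (simp add: algebra_simps)
  ultimately show ?thesis by (metis dvd_diff_commute dvd_triv_left dvd_diff_right_iff)
qed

text \<open>A step to a neighbour changes the ladder number by 1 or by \<open>k\<close>, neither of
  which is divisible by \<open>Suc k\<close>.\<close>

lemma residue_neighbour:
  assumes "1 \<le> k"
  shows "residue (Suc k) (Suc a, b) \<noteq> residue (Suc k) (a, b)"
    "residue (Suc k) (a, Suc b) \<noteq> residue (Suc k) (a, b)"
proof -
  have "\<not> int (Suc k) dvd 1" using assms by (simp add: zdvd1_eq)
  then show "residue (Suc k) (Suc a, b) \<noteq> residue (Suc k) (a, b)"
    by (simp add: residue_eq_iff)
  have "\<not> int (Suc k) dvd int k" using assms by (auto dest: zdvd_imp_le)
  then show "residue (Suc k) (a, Suc b) \<noteq> residue (Suc k) (a, b)"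
    by (simp add: residue_eq_iff)
qed

text \<open>The set of positions read after \<open>x\<close>, up to the row of \<open>x\<close> in the next ladder of the
  same residue.\<close>

definition window :: "nat \<Rightarrow> box \<Rightarrow> box \<Rightarrow> bool" where
  "window l x y \<longleftrightarrow> ladder_key l x < ladder_key l y \<and>
     ladder_key l y \<le> (fst (ladder_key l x) + l, fst x)"

text \<open>The upper end of a window is the key of its base with \<open>l\<close> added to the
  first entry, so it moves on with the base.\<close>

lemma window_right:
  "window l x z \<Longrightarrow> ladder_key l x < ladder_key l y \<Longrightarrow> ladder_key l y < ladder_key l z \<Longrightarrow>
   window l y z"
  by (cases x; cases y; cases z) (auto simp: window_def ladder_key_def)

lemma window_left:
  "window l x z \<Longrightarrow> ladder_key l x < ladder_key l y \<Longrightarrow> ladder_key l y < ladder_key l z \<Longrightarrow>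
   window l x y"
  by (auto simp: window_def intro: order.trans less_imp_le)

text \<open>Equal residues make the ladder numbers differ by a multiple of \<open>Suc k\<close>, and
  a window reaches no further than a difference of \<open>Suc k\<close>.\<close>

lemma window_residue_cases:
  assumes "window (Suc k) (p, q) (p', q')"
    and "residue (Suc k) (p, q) = residue (Suc k) (p', q')"
  shows "p + k * q = p' + k * q' \<and> p < p' \<or> p + k * q + Suc k = p' + k * q' \<and> p' \<le> p"
proof -
  let ?u = "p + k * q" and ?v = "p' + k * q'"
  have w: "?u < ?v \<or> ?u = ?v \<and> p < p'" "?v < ?u + Suc k \<or> ?v = ?u + Suc k \<and> p' \<le> p"
    using assms(1) by (auto simp: window_def ladder_key_def)
  have "int (Suc k) dvd int ?v - int ?u" using assms(2) by (metis residue_eq_iff)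
  then have "?u < ?v \<Longrightarrow> int (Suc k) \<le> int ?v - int ?u" by (rule zdvd_imp_le) linarith
  then show ?thesis using w by linarith
qed

text \<open>Within a ladder, one column to the left means \<open>k\<close> rows down. The number
  \<open>m\<close> will be the arm of an illegal hook.\<close>

lemma same_ladder:
  fixes a b c d k :: nat
  assumes "a + k * b = c + k * d" "a < c"
  obtains m where "1 \<le> m" "b = d + m" "c = a + k * m"
proof -
  have "d < b"
  proof (rule ccontr)
    assume "\<not> d < b"
    then have "k * b \<le> k * d" by simp
    then show False using assms by linarith
  qed
  then obtain m where "1 \<le> m" "b = d + m" by (metis less_imp_add_positive less_eq_Suc_le One_nat_def)
  moreover then have "c = a + k * m" using assms by (simp add: algebra_simps)
  ultimately show ?thesis using that by blast
qed

text \<open>In the same ladder, \<open>x\<close> is the hand of the hook and the box above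
  \<open>y\<close> its foot. In the next ladder, the box to the left of \<open>y\<close> is the hand
  and \<open>x\<close> the foot.\<close>

lemma removable_window_addable:
  assumes D: "young_diagram D" and k: "2 \<le> k"
    and rem: "removable (Suc k) i D x" and add: "addable (Suc k) i D y"
    and win: "window (Suc k) x y"
  shows "illegal k D"
proof -
  obtain p q p' q' where xy: "x = (p, q)" "y = (p', q')" by (cases x, cases y)
  have x: "(p, q) \<in> D" "(Suc p, q) \<notin> D" "(p, Suc q) \<notin> D" "residue (Suc k) (p, q) = i"
    using rem removable_iff[OF D] xy by auto
  have y: "(p', q') \<notin> D" "1 \<le> p'" "1 \<le> q'" "p' = 1 \<or> (p' - 1, q') \<in> D" "q' = 1 \<or> (p', q' - 1) \<in> D"
    "residue (Suc k) (p', q') = i"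
    using add addable_iff[OF D] xy by auto
  have pos: "1 \<le> p" "1 \<le> q" using young_diagram_pos[OF D x(1)] by auto
  from window_residue_cases[OF win[unfolded xy]] x(4) y(6)
  consider "p + k * q = p' + k * q'" "p < p'" | "p + k * q + Suc k = p' + k * q'" "p' \<le> p"
    by auto
  then show ?thesis
  proof cases
    case 1
    then obtain m where m: "1 \<le> m" "q = q' + m" "p' = p + k * m" by (rule same_ladder)
    have "p' \<noteq> 1" using 1 pos by simp
    then show ?thesis using illegalI[of m p q' D k] m x y by auto
  next
    case 2
    \<comment> \<open>The diagonal neighbour of \<open>x\<close> lies in the ladder of
      \<open>y\<close>, so this case too is about two positions of one ladder.\<close>
    then have "p' + k * q' = Suc p + k * Suc q" "p' < Suc p" by auto
    then obtain m where m: "1 \<le> m" "q' = Suc q + m" "Suc p = p' + k * m" by (rule same_ladder)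
    have "p' + k * m - 1 = p" "q' - 1 = q + m" "q' \<noteq> 1" using m pos by auto
    then show ?thesis using illegalI[of m p' q D k] m x y by auto
  qed
qed

text \<open>The new hook has \<open>y\<close> as one end, and \<open>z\<close> is the position just
  outside the other end: right of the hand or below the foot. If \<open>z\<close> were not addable,
  the hook moved one row up or one column left would already be illegal in \<open>D\<close>.\<close>

lemma illegal_insert:
  assumes D: "young_diagram D" and k: "2 \<le> k" and add: "addable (Suc k) i D y"
    and ill: "illegal k (insert y D)" and leg: "\<not> illegal k D"
  obtains z where "addable (Suc k) i D z" "window (Suc k) y z"
proof -
  obtain c d where y_eq: "y = (c, d)" by (cases y)
  have y: "(c, d) \<notin> D" "1 \<le> c" "1 \<le> d" "c = 1 \<or> (c - 1, d) \<in> D" "d = 1 \<or> (c, d - 1) \<in> D"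
    "residue (Suc k) (c, d) = i"
    using add addable_iff[OF D] y_eq by auto
  obtain a b m where m: "1 \<le> m"
    and E: "(a, b + m) \<in> insert (c, d) D" "(a, Suc (b + m)) \<notin> insert (c, d) D"
      "(a + k * m - 1, b) \<in> insert (c, d) D" "(a + k * m, b) \<notin> insert (c, d) D"
    using ill unfolding y_eq by (rule illegalE)
  have km: "2 \<le> k * m" using mult_le_mono[OF k m] by simp
  have pos: "1 \<le> a" "1 \<le> b"
    using E y young_diagram_pos[OF D] by auto
  \<comment> \<open>\<open>y\<close> is the foot in the first case and the hand in the
    second.\<close>
  consider "a + k * m - 1 = c" "b = d" "(a, b + m) \<in> D"
    | "a = c" "b + m = d" "(a + k * m - 1, b) \<in> D"
    using illegalI[OF m, of a b D k] leg E m by auto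
  then show ?thesis
  proof cases
    case 1
    have "a = 1 \<or> (a - 1, Suc (b + m)) \<in> D"
    proof (rule ccontr)
      assume not: "\<not> ?thesis"
      have "illegal k D"
      proof (rule illegalI[OF m])
        show "(a - 1, b + m) \<in> D"
          using young_diagram_closed[OF D 1(3), of "a - 1" "b + m"] not pos by auto
        show "(a - 1, Suc (b + m)) \<notin> D" using not by simp
        have "a - 1 + k * m - 1 = c - 1" "a - 1 + k * m = c" "c \<noteq> 1" using 1 pos not km by auto
        then show "(a - 1 + k * m - 1, b) \<in> D" "(a - 1 + k * m, b) \<notin> D" using y 1 by auto
      qed
      then show False using leg by simp
    qed
    moreover have key: "a + k * Suc (b + m) = c + k * d + Suc k"
      using 1 pos km by (simp add: algebra_simps)
    then have "residue (Suc k) (a, Suc (b + m)) = i"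
      unfolding y(6)[symmetric] residue_eq_iff key by simp
    ultimately have "addable (Suc k) i D (a, Suc (b + m))"
      using E pos 1 by (auto simp: addable_iff[OF D])
    moreover have "window (Suc k) y (a, Suc (b + m))"
      using key 1 km unfolding y_eq by (auto simp: window_def ladder_key_def)
    ultimately show ?thesis by (rule that)
  next
    case 2
    have "b = 1 \<or> (a + k * m, b - 1) \<in> D"
    proof (rule ccontr)
      assume not: "\<not> ?thesis"
      have "illegal k D"
      proof (rule illegalI[OF m])
        have "b - 1 + m = d - 1" "Suc (b - 1 + m) = d" "d \<noteq> 1" using 2 pos not m by auto
        then show "(a, b - 1 + m) \<in> D" "(a, Suc (b - 1 + m)) \<notin> D" using y 2 by auto
        show "(a + k * m - 1, b - 1) \<in> D"
          using young_diagram_closed[OF D 2(3), of "a + k * m - 1" "b - 1"] not pos km by auto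
        show "(a + k * m, b - 1) \<notin> D" using not by simp
      qed
      then show False using leg by simp
    qed
    moreover have key: "a + k * m + k * b = c + k * d"
      using 2(1) unfolding 2(2)[symmetric] by (simp add: algebra_simps)
    then have "residue (Suc k) (a + k * m, b) = i"
      unfolding y(6)[symmetric] residue_eq_iff key by simp
    ultimately have "addable (Suc k) i D (a + k * m, b)"
      using E pos 2 by (auto simp: addable_iff[OF D])
    moreover have "window (Suc k) y (a + k * m, b)"
      using key 2 k m unfolding y_eq by (auto simp: window_def ladder_key_def)
    ultimately show ?thesis by (rule that)
  qed
qed

text \<open>Here \<open>x\<close> lies just outside one end of the new hook, and \<open>w\<close> is
  the other end. If \<open>w\<close> were not removable, the hook moved one row down or one column
  right would have \<open>x\<close> as an end and be illegal in \<open>D\<close>.\<close>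

lemma illegal_remove:
  assumes D: "young_diagram D" and k: "2 \<le> k" and rem: "removable (Suc k) i D x"
    and ill: "illegal k (D - {x})" and leg: "\<not> illegal k D"
  obtains w where "removable (Suc k) i D w" "window (Suc k) w x"
proof -
  obtain c d where x_eq: "x = (c, d)" by (cases x)
  have x: "(c, d) \<in> D" "(Suc c, d) \<notin> D" "(c, Suc d) \<notin> D" "residue (Suc k) (c, d) = i"
    using rem removable_iff[OF D] x_eq by auto
  obtain a b m where m: "1 \<le> m"
    and E: "(a, b + m) \<in> D - {(c, d)}" "(a, Suc (b + m)) \<notin> D - {(c, d)}"
      "(a + k * m - 1, b) \<in> D - {(c, d)}" "(a + k * m, b) \<notin> D - {(c, d)}"
    using ill unfolding x_eq by (rule illegalE)
  have km: "2 \<le> k * m" using mult_le_mono[OF k m] by simp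
  have pos: "1 \<le> a" "1 \<le> b"
    using E(1,3) young_diagram_pos[OF D, of a "b + m"] young_diagram_pos[OF D, of "a + k * m - 1" b]
    by simp_all
  have "(a, Suc (b + m)) = (c, d) \<or> (a + k * m, b) = (c, d)"
    using illegalI[OF m, of a b D k] leg E by blast
  \<comment> \<open>\<open>x\<close> lies just below the foot in the first case and just right of
    the hand in the second.\<close>
  then consider "a + k * m = c" "b = d" "(a, Suc (b + m)) \<notin> D"
    | "a = c" "Suc (b + m) = d" "(a + k * m, b) \<notin> D"
    using E by fastforce
  then show ?thesis
  proof cases
    case 1
    have "(Suc a, b + m) \<notin> D"
    proof
      assume in_D: "(Suc a, b + m) \<in> D"
      have "illegal k D"
      proof (rule illegalI[OF m in_D])
        show "(Suc a, Suc (b + m)) \<notin> D"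
          using young_diagram_closed[OF D, of "Suc a" "Suc (b + m)" a "Suc (b + m)"] 1 pos by auto
        show "(Suc a + k * m - 1, b) \<in> D" "(Suc a + k * m, b) \<notin> D" using x 1 by auto
      qed
      then show False using leg by simp
    qed
    moreover have key: "a + k * (b + m) = c + k * d" using 1 by (auto simp: algebra_simps)
    then have "residue (Suc k) (a, b + m) = i"
      unfolding x(4)[symmetric] residue_eq_iff key by simp
    ultimately have "removable (Suc k) i D (a, b + m)"
      using E 1 by (auto simp: removable_iff[OF D])
    moreover have "window (Suc k) (a, b + m) x"
      using key 1 k m unfolding x_eq by (auto simp: window_def ladder_key_def)
    ultimately show ?thesis by (rule that)
  next
    case 2
    have "(a + k * m - 1, Suc b) \<notin> D"
    proof
      assume in_D: "(a + k * m - 1, Suc b) \<in> D"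
      have "illegal k D"
      proof (rule illegalI[OF m _ _ in_D])
        show "(a, Suc b + m) \<in> D" "(a, Suc (Suc b + m)) \<notin> D" using x 2 by auto
        show "(a + k * m, Suc b) \<notin> D"
          using young_diagram_closed[OF D, of "a + k * m" "Suc b" "a + k * m" b] 2 pos by auto
      qed
      then show False using leg by simp
    qed
    moreover have key: "c + k * d = a + k * m - 1 + k * b + Suc k"
      using 2 pos km by (auto simp: algebra_simps)
    then have "residue (Suc k) (c, d) = residue (Suc k) (a + k * m - 1, b)"
      unfolding residue_eq_iff key by simp
    ultimately have "removable (Suc k) i D (a + k * m - 1, b)"
      using E 2 x pos km by (auto simp: removable_iff[OF D])
    moreover have "window (Suc k) (a + k * m - 1, b) x"
      using key 2 km unfolding x_eq by (auto simp: window_def ladder_key_def)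
    ultimately show ?thesis by (rule that)
  qed
qed

text \<open>The last box of the diagram in reading order works.\<close>

lemma ex_last_removable:
  assumes D: "young_diagram D" "D \<noteq> {}" and k: "2 \<le> k" and leg: "\<not> illegal k D"
  obtains x where "removable (Suc k) (residue (Suc k) x) D x"
    and "\<And>y. addable (Suc k) (residue (Suc k) x) D y \<Longrightarrow>
           \<not> ladder_key (Suc k) x < ladder_key (Suc k) y"
proof -
  let ?key = "ladder_key (Suc k)"
  have fin: "finite (?key ` D)" using D by (simp add: young_diagram_def)
  have "Max (?key ` D) \<in> ?key ` D" using Max_in[OF fin] D(2) by simp
  then obtain x where x: "x \<in> D" "?key x = Max (?key ` D)" by force
  have max: "?key y \<le> ?key x" if "y \<in> D" for y
    using fin that x by simp
  obtain a b where ab: "x = (a, b)" by (cases x)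
  have "(Suc a, b) \<notin> D" "(a, Suc b) \<notin> D"
    using max[of "(Suc a, b)"] max[of "(a, Suc b)"] k ab by (auto simp: ladder_key_def)
  then have rem: "removable (Suc k) (residue (Suc k) x) D x"
    using x ab by (simp add: removable_iff[OF D(1)])
  have "\<not> ?key x < ?key y" if add: "addable (Suc k) (residue (Suc k) x) D y" for y
  proof
    assume less: "?key x < ?key y"
    obtain c d where cd: "y = (c, d)" by (cases y)
    have y: "(c, d) \<notin> D" "1 \<le> c" "1 \<le> d" "c = 1 \<or> (c - 1, d) \<in> D" "d = 1 \<or> (c, d - 1) \<in> D"
      using add addable_iff[OF D(1)] cd by auto
    \<comment> \<open>This excludes \<open>y = (1, 1)\<close>, the only addable position with no box
      above it or to its left.\<close>
    have "(1, 1) \<in> D"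
      using young_diagram_closed[OF D(1), of a b 1 1] young_diagram_pos[OF D(1), of a b] x ab
      by simp
    then consider "(c - 1, d) \<in> D" | "(c, d - 1) \<in> D" using y by auto
    \<comment> \<open>A neighbour of \<open>y\<close> in \<open>D\<close> is not read after
      \<open>x\<close>, and the step from it to \<open>y\<close> raises the ladder number by at most
      \<open>k\<close>. So \<open>y\<close> comes before the next ladder of its residue.\<close>
    then have "fst (?key y) \<le> fst (?key x) + k"
    proof cases
      case 1
      then show ?thesis using max[OF 1] y k young_diagram_pos[OF D(1) 1]
        by (auto simp: ladder_key_def ab cd)
    next
      case 2
      have "k * d = k * (d - 1) + k" using y by (cases d) auto
      then show ?thesis using max[OF 2] by (auto simp: ladder_key_def ab cd)
    qed
    then have "window (Suc k) x y" using less by (cases "?key y") (auto simp: window_def)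
    then show False using removable_window_addable[OF D(1) k rem add] leg by simp
  qed
  then show ?thesis using rem that by blast
qed

section \<open>The ladder signature\<close>

lemma sorted_key_list_of_set_ladder:
  assumes "2 \<le> l" "finite X"
  shows "set (sorted_key_list_of_set (ladder_key l) X) = X"
    and "sorted_wrt (\<lambda>x y. ladder_key l x < ladder_key l y)
           (sorted_key_list_of_set (ladder_key l) X)"
proof -
  let ?L = "sorted_key_list_of_set (ladder_key l)"
  have inj: "ladder_key l x = ladder_key l y \<longleftrightarrow> x = y" for x y
    using inj_ladder_key[OF assms(1)] by (auto dest: injD)
  \<comment> \<open>Insertions commute because the key is injective, so the list does not depend on
    the order in which the set is enumerated.\<close>
  interpret folding_on UNIV "insort_key (ladder_key l)" "[]"
  proof
    fix x y
    show "insort_key (ladder_key l) y \<circ> insort_key (ladder_key l) x =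
        insort_key (ladder_key l) x \<circ> insort_key (ladder_key l) y"
      using insort_key_left_comm[of "ladder_key l" x y] inj by (cases "x = y") auto
  qed
  have L: "?L {} = []" "finite A \<Longrightarrow> x \<notin> A \<Longrightarrow> ?L (insert x A) = insort_key (ladder_key l) x (?L A)"
    for x A
    by (simp_all add: sorted_key_list_of_set_def)
  have "set (?L X) = X \<and> sorted (map (ladder_key l) (?L X)) \<and> distinct (?L X)"
    using assms(2)
    by (induction X) (auto simp: L set_insort_key sorted_insort_key distinct_insort)
  then show "set (?L X) = X" "sorted_wrt (\<lambda>x y. ladder_key l x < ladder_key l y) (?L X)"
    using inj_on_subset[OF inj_ladder_key[OF assms(1)] subset_UNIV]
    by (simp_all add: strict_sorted_iff distinct_map flip: sorted_wrt_map)
qed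

lemma set_ladder_signature:
  assumes "2 \<le> l"
  shows "p \<in> set (ladder_signature l i D) \<longleftrightarrow>
    (fst p = Plus \<and> addable l i D (snd p) \<or> fst p = Minus \<and> removable l i D (snd p))"
  unfolding ladder_signature_def
  using sorted_key_list_of_set_ladder(1)[OF assms finite_signature_boxes, of l i D]
  by (cases p) (auto simp: addable_def removable_def image_iff)

lemma sorted_ladder_signature:
  assumes "2 \<le> l"
  shows "sorted_wrt (\<lambda>p q. ladder_key l (snd p) < ladder_key l (snd q)) (ladder_signature l i D)"
  unfolding ladder_signature_def
  using sorted_key_list_of_set_ladder(2)[OF assms finite_signature_boxes, of l i D]
  by (simp add: sorted_wrt_map)

lemma sorted_wrt_split:
  assumes "sorted_wrt R (us @ p # vs)"
  shows "q \<in> set us \<Longrightarrow> R q p" and "q \<in> set vs \<Longrightarrow> R p q"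
  using assms by (auto simp: sorted_wrt_append)

text \<open>After reduction only \<open>Minus\<close> stands to the right of the pivot, so
  \<open>y\<close> is the box of the rightmost \<open>Plus\<close>.\<close>

lemma f_hat_eq_pivot:
  assumes "ladder_signature l i D = us @ (Plus, y) # vs" "pivot us vs"
  shows "f_hat l i D = Some (insert y D)"
proof -
  have "filter (\<lambda>(s, x). s = Plus) (reduce vs) = []"
    using assms(2) by (auto simp: pivot_def filter_empty_conv)
  then show ?thesis
    using assms
    by (simp add: f_hat_def ladder_cogood_def reduced_signature_eq_reduce reduce_pivot)
qed

lemma f_hat_SomeE:
  assumes "f_hat l i D = Some E"
  obtains us y vs where "ladder_signature l i D = us @ (Plus, y) # vs" "pivot us vs"
    "E = insert y D"
proof -
  have "filter (\<lambda>(s, x). s = Plus) (reduce (ladder_signature l i D)) \<noteq> []"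
    using assms
    by (auto simp: f_hat_def ladder_cogood_def reduced_signature_eq_reduce split: if_splits)
  then obtain p where "p \<in> set (reduce (ladder_signature l i D))" "fst p = Plus"
    by (auto simp: filter_empty_conv)
  then obtain us y vs where *: "ladder_signature l i D = us @ (Plus, y) # vs" "pivot us vs"
    using ex_Plus_pivot by blast
  with that assms f_hat_eq_pivot[OF *] show ?thesis by auto
qed

lemma f_hat_legal:
  assumes D: "young_diagram D" and k: "2 \<le> k" and leg: "\<not> illegal k D"
    and f: "f_hat (Suc k) i D = Some E"
  shows "young_diagram E \<and> \<not> illegal k E"
proof -
  have l: "2 \<le> Suc k" using k by simp
  obtain us y vs where s: "ladder_signature (Suc k) i D = us @ (Plus, y) # vs"
    and piv: "pivot us vs" and E: "E = insert y D"
    using f by (rule f_hat_SomeE)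
  have in_s: "p \<in> set us \<union> {(Plus, y)} \<union> set vs \<longleftrightarrow>
      fst p = Plus \<and> addable (Suc k) i D (snd p) \<or> fst p = Minus \<and> removable (Suc k) i D (snd p)" for p
    using set_ladder_signature[OF l, of p i D] s by auto
  have sorted: "sorted_wrt (\<lambda>p q. ladder_key (Suc k) (snd p) < ladder_key (Suc k) (snd q))
      (us @ (Plus, y) # vs)"
    using sorted_ladder_signature[OF l, of i D] s by simp
  have add: "addable (Suc k) i D y" using in_s[of "(Plus, y)"] by simp
  have "\<not> illegal k E"
  proof
    assume "illegal k E"
    then obtain z where z: "addable (Suc k) i D z" "window (Suc k) y z"
      using illegal_insert[OF D k add _ leg] E by blast
    have "ladder_key (Suc k) y < ladder_key (Suc k) z" using z by (simp add: window_def)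
    then have "(Plus, z) \<in> set vs"
      using in_s[of "(Plus, z)"] z sorted_wrt_split(1)[OF sorted, of "(Plus, z)"] by auto
    then obtain ms vs' where vs: "vs = ms @ (Plus, z) # vs'" by (meson split_list)
    \<comment> \<open>The \<open>Plus\<close> at \<open>z\<close> must be cancelled, which provides
      a removable box \<open>w\<close> between \<open>y\<close> and \<open>z\<close>.\<close>
    obtain w where w: "(Minus, w) \<in> set ms"
      using pivot_Plus_right[OF piv vs] by force
    have sorted': "sorted_wrt (\<lambda>p q. ladder_key (Suc k) (snd p) < ladder_key (Suc k) (snd q))
        ((us @ (Plus, y) # ms) @ (Plus, z) # vs')"
      using sorted vs by simp
    have "ladder_key (Suc k) y < ladder_key (Suc k) w" "ladder_key (Suc k) w < ladder_key (Suc k) z"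
      using sorted_wrt_split(2)[OF sorted, of "(Minus, w)"] w vs
        sorted_wrt_split(1)[OF sorted', of "(Minus, w)"]
      by auto
    then have "window (Suc k) w z" using window_right z by blast
    moreover have "removable (Suc k) i D w" using in_s[of "(Minus, w)"] w vs by auto
    ultimately show False using removable_window_addable[OF D k _ z(1)] leg by blast
  qed
  moreover have "young_diagram E" using add E by (simp add: addable_def)
  ultimately show ?thesis by simp
qed

section \<open>Removing a box and recovering it with \<open>f_hat\<close>\<close>

lemma addable_removable_after_remove:
  assumes D: "young_diagram D" and k: "1 \<le> k" and rem: "removable (Suc k) i D x" and ne: "z \<noteq> x"
  shows "addable (Suc k) i (D - {x}) z \<longleftrightarrow> addable (Suc k) i D z"
    and "removable (Suc k) i (D - {x}) z \<longleftrightarrow> removable (Suc k) i D z"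
proof -
  obtain a b where z: "z = (a, b)" by (cases z)
  have E: "young_diagram (D - {x})" and rx: "residue (Suc k) x = i"
    using rem by (simp_all add: removable_def)
  \<comment> \<open>Whether \<open>z\<close> is addable or removable depends only on
    \<open>z\<close> and its neighbours. Those have residues other than \<open>i\<close>, so
    \<open>x\<close> is none of them.\<close>
  have 1: "(Suc a, b) \<noteq> x" "(a, Suc b) \<noteq> x" if "residue (Suc k) (a, b) = i"
    using residue_neighbour[OF k, of a b] that rx by auto
  have 2: "(a - 1, b) \<noteq> x" if "residue (Suc k) (a, b) = i" "1 \<le> a"
    using residue_neighbour(1)[OF k, of "a - 1" b] that rx by auto
  have 3: "(a, b - 1) \<noteq> x" if "residue (Suc k) (a, b) = i" "1 \<le> b"
    using residue_neighbour(2)[OF k, of a "b - 1"] that rx by auto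
  show "addable (Suc k) i (D - {x}) z \<longleftrightarrow> addable (Suc k) i D z"
    using ne 2 3 unfolding z by (auto simp: addable_iff[OF D] addable_iff[OF E])
  show "removable (Suc k) i (D - {x}) z \<longleftrightarrow> removable (Suc k) i D z"
    using ne 1 unfolding z by (auto simp: removable_iff[OF D] removable_iff[OF E])
qed

text \<open>The box \<open>x\<close> turns from removable into addable and all others keep their
  sign, so the same boxes are read in the same order.\<close>

lemma ladder_signature_remove:
  assumes D: "young_diagram D" and k: "1 \<le> k" and rem: "removable (Suc k) i D x"
    and s: "ladder_signature (Suc k) i D = us @ (Minus, x) # vs"
  shows "ladder_signature (Suc k) i (D - {x}) = us @ (Plus, x) # vs"
proof -
  let ?E = "D - {x}"
  let ?L = "sorted_key_list_of_set (ladder_key (Suc k))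
    {z. addable (Suc k) i D z \<or> removable (Suc k) i D z}"
  let ?f = "\<lambda>D z. (if addable (Suc k) i D z then Plus else Minus, z)"
  have l: "2 \<le> Suc k" using k by simp
  have xE: "addable (Suc k) i ?E x"
    using rem D by (simp add: addable_def removable_def insert_absorb)
  have "{z. addable (Suc k) i ?E z \<or> removable (Suc k) i ?E z} =
        {z. addable (Suc k) i D z \<or> removable (Suc k) i D z}"
    using addable_removable_after_remove[OF D k rem] rem xE by (metis (lifting))
  then have sE: "ladder_signature (Suc k) i ?E = map (?f ?E) ?L"
    by (simp add: ladder_signature_def)
  have "map (?f D) ?L = us @ (Minus, x) # vs" using s by (simp add: ladder_signature_def)
  then obtain L1 L2 where L: "?L = L1 @ x # L2" "us = map (?f D) L1" "vs = map (?f D) L2"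
    by (auto simp: map_eq_append_conv map_eq_Cons_conv)
  have same: "addable (Suc k) i ?E z \<longleftrightarrow> addable (Suc k) i D z" if "x \<notin> A" "z \<in> A" for z A
    using addable_removable_after_remove(1)[OF D k rem, of z] that by blast
  have "sorted_wrt (\<lambda>x y. ladder_key (Suc k) x < ladder_key (Suc k) y) (L1 @ x # L2)"
    using sorted_key_list_of_set_ladder(2)[OF l finite_signature_boxes, of "Suc k" i D] L by simp
  then have "x \<notin> set L1" "x \<notin> set L2" by (auto simp: sorted_wrt_append)
  then have "map (?f ?E) L1 = map (?f D) L1" "map (?f ?E) L2 = map (?f D) L2"
    by (auto simp: same)
  then show ?thesis using sE L xE by simp
qed

lemma ex_legal_predecessor:
  assumes D: "young_diagram D" "D \<noteq> {}" and k: "2 \<le> k" and leg: "\<not> illegal k D"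
  obtains i x where "0 \<le> i" "i < int (Suc k)" "x \<in> D" "young_diagram (D - {x})"
    "\<not> illegal k (D - {x})" "f_hat (Suc k) i (D - {x}) = Some D"
proof -
  have l: "2 \<le> Suc k" and k1: "1 \<le> k" using k by simp_all
  obtain x0 where x0: "removable (Suc k) (residue (Suc k) x0) D x0"
    and last: "\<And>y. addable (Suc k) (residue (Suc k) x0) D y \<Longrightarrow>
           \<not> ladder_key (Suc k) x0 < ladder_key (Suc k) y"
    using ex_last_removable[OF D k leg] by blast
  \<comment> \<open>The box \<open>x0\<close> only serves to choose a residue; the box removed in
    the end is the first surviving \<open>Minus\<close> of that residue and may differ from
    \<open>x0\<close>.\<close>
  define i where "i = residue (Suc k) x0"
  have i: "0 \<le> i" "i < int (Suc k)" by (cases x0; simp add: i_def residue_def)+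
  define s where "s = ladder_signature (Suc k) i D"
  have in_s: "p \<in> set s \<longleftrightarrow>
      fst p = Plus \<and> addable (Suc k) i D (snd p) \<or> fst p = Minus \<and> removable (Suc k) i D (snd p)" for p
    unfolding s_def by (rule set_ladder_signature[OF l])
  have sorted: "sorted_wrt (\<lambda>p q. ladder_key (Suc k) (snd p) < ladder_key (Suc k) (snd q)) s"
    unfolding s_def by (rule sorted_ladder_signature[OF l])
  have "(Minus, x0) \<in> set s" using in_s x0 i_def by simp
  then obtain us0 vs0 where s0: "s = us0 @ (Minus, x0) # vs0" by (meson split_list)
  have "fst p = Minus" if "p \<in> set vs0" for p
  proof (rule ccontr)
    assume "fst p \<noteq> Minus"
    then have "addable (Suc k) i D (snd p)" using in_s[of p] that s0 by auto
    moreover have "ladder_key (Suc k) x0 < ladder_key (Suc k) (snd p)"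
      using sorted s0 that by (auto simp: sorted_wrt_append)
    ultimately show False using last i_def by blast
  qed
  then have t: "\<forall>p\<in>set ((Minus, x0) # vs0). fst p = Minus" by simp
  then have "reduce s \<noteq> []" "last (reduce s) = last ((Minus, x0) # vs0)"
    using last_reduce_append_Minus[OF _ t, of us0] s0 by auto
  then have "last (reduce s) \<in> set (reduce s)" "fst (last (reduce s)) = Minus"
    using t by (auto dest: last_in_set)
  then obtain us x vs where s: "s = us @ (Minus, x) # vs" and piv: "pivot us vs"
    using ex_Minus_pivot by blast
  have rem: "removable (Suc k) i D x" using in_s[of "(Minus, x)"] s by auto
  then have x: "x \<in> D" "young_diagram (D - {x})" by (simp_all add: removable_def)
  \<comment> \<open>The split remains a pivot after the sign of \<open>x\<close> is flipped, so
    \<open>x\<close> is the cogood box of \<open>D - {x}\<close>.\<close>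
  have "f_hat (Suc k) i (D - {x}) = Some D"
    using f_hat_eq_pivot[OF ladder_signature_remove[OF D(1) k1 rem s[unfolded s_def]] piv] x
    by (simp add: insert_absorb)
  moreover have "\<not> illegal k (D - {x})"
  proof
    assume "illegal k (D - {x})"
    then obtain w where w: "removable (Suc k) i D w" "window (Suc k) w x"
      using illegal_remove[OF D(1) k rem _ leg] by blast
    have "ladder_key (Suc k) w < ladder_key (Suc k) x" using w by (simp add: window_def)
    then have "(Minus, w) \<in> set us"
      using in_s[of "(Minus, w)"] w sorted_wrt_split(2)[OF sorted[unfolded s], of "(Minus, w)"] s by auto
    then obtain us' ms where us: "us = us' @ (Minus, w) # ms" by (meson split_list)
    \<comment> \<open>The \<open>Minus\<close> at \<open>w\<close> must be cancelled, which provides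
      an addable box \<open>y\<close> between \<open>w\<close> and \<open>x\<close>.\<close>
    obtain y where y: "(Plus, y) \<in> set ms"
      using pivot_Minus_left[OF piv us] by force
    have sorted': "sorted_wrt (\<lambda>p q. ladder_key (Suc k) (snd p) < ladder_key (Suc k) (snd q))
        (us' @ (Minus, w) # (ms @ (Minus, x) # vs))"
      using sorted s us by simp
    have "ladder_key (Suc k) w < ladder_key (Suc k) y" "ladder_key (Suc k) y < ladder_key (Suc k) x"
      using sorted_wrt_split(1)[OF sorted[unfolded s], of "(Plus, y)"] y us
        sorted_wrt_split(2)[OF sorted', of "(Plus, y)"]
      by auto
    then have "window (Suc k) w y" using window_left w by blast
    moreover have "addable (Suc k) i D y" using in_s[of "(Plus, y)"] y us s by auto
    ultimately show False using removable_window_addable[OF D(1) k w(1)] leg by blast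
  qed
  ultimately show ?thesis using that i x by blast
qed

section \<open>Nodes of the crystal and diagrams without illegal hooks\<close>

lemma crystal_node_legal:
  assumes "D \<in> ladder_crystal_nodes (Suc k)" "2 \<le> k"
  shows "young_diagram D \<and> \<not> illegal k D"
  using assms(1)
proof induction
  case empty
  show ?case by (simp add: young_diagram_def illegal_def)
next
  case (step D i E)
  then show ?case using f_hat_legal[OF _ assms(2)] by blast
qed

text \<open>By induction on the number of boxes, descending to a legal predecessor from which
  \<open>f_hat\<close> leads back.\<close>

lemma legal_crystal_node:
  assumes "young_diagram D" "\<not> illegal k D" "2 \<le> k"
  shows "D \<in> ladder_crystal_nodes (Suc k)"
  using assms(1,2)
proof (induction "card D" arbitrary: D rule: less_induct)
  case less
  show ?case
  proof (cases "D = {}")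
    case True
    then show ?thesis by (simp add: ladder_crystal_nodes.empty)
  next
    case False
    then obtain i x where i: "0 \<le> i" "i < int (Suc k)" and x: "x \<in> D" "young_diagram (D - {x})"
        "\<not> illegal k (D - {x})" and f: "f_hat (Suc k) i (D - {x}) = Some D"
      using ex_legal_predecessor[OF less.prems(1) _ assms(3) less.prems(2)] by blast
    have "card (D - {x}) < card D"
      using x(1) less.prems(1) by (intro card_Diff1_less) (auto simp: young_diagram_def)
    then show ?thesis
      using ladder_crystal_nodes.step[OF less.hyps i f] x by blast
  qed
qed

theorem theorem13p5:
  fixes l :: nat and D :: "box set"
  assumes "l \<ge> 3" and "young_diagram D"
  shows "D \<in> ladder_crystal_nodes l \<longleftrightarrow>
         \<not> (\<exists>x\<in>D. hook_length D x = l * arm D x)"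
proof -
  \<comment> \<open>\<open>k\<close> is \<open>l - 1\<close>, the weight of the column index in the
    ladder number.\<close>
  obtain k where k: "l = Suc k" "2 \<le> k" using assms(1) by (cases l) auto
  then show ?thesis
    using ex_hook_iff_illegal[OF assms(2), of k] crystal_node_legal[OF _ k(2), of D]
      legal_crystal_node[OF assms(2) _ k(2)]
    by auto
qed

end
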